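(* Let $\mathbb{F}$ be a field with characteristic $p$ (with the convention $p=\infty$ if the identity has infinite additive order), and let $A$ and $B$ be finite subsets of $\mathbb{F}$. Let $k,m,n$ be nonnegative integers and let $Q(x,y)\in\mathbb{F}[x,y]$ have degree less than $k+m+n$. If $|A|>k$ and $|B|>m$, then $$|\{a+b : a\in A,\ b\in B,\ \text{and}\ a^kb^m(a+b)^n\neq Q(a,b)\}|\ge\min\{p-n,\ |A|+|B|-k-m-n-1\}.$$
   Context: The characteristic of a field $\mathbb{F}$ is defined here as the additive order of its multiplicative identity; it is either a prime or $\infty$ (so $p=\infty$ corresponds to what is usually called characteristic $0$, and then $p-n=\infty$). The degree of $Q(x,y)$ is the total degree, and the zero polynomial is regarded as having degree less than every nonnegative integer. *)

theory Defs
  imports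
    "HOL-Computational_Algebra.Polynomial"
    "HOL-Library.Extended_Real"
begin

text \<open>
  The library's \<open>CHAR('a)\<close> is \<open>0\<close> when no positive multiple of \<open>1\<close> vanishes;
  here the characteristic is the additive order of \<open>1\<close>, hence \<open>\<infinity>\<close> in that case.
\<close>

definition ext_char :: "'a::semiring_1 itself \<Rightarrow> ereal"
  where "ext_char _ = (if CHAR('a) = 0 then \<infinity> else ereal (real CHAR('a)))"

text \<open>
  A polynomial \<open>Q\<close> in two variables \<open>x\<close> and \<open>y\<close> over \<open>'a\<close> is represented as a polynomial in \<open>y\<close>
  whose coefficients are polynomials in \<open>x\<close>, so that \<open>coeff (coeff Q j) i\<close> is the
  coefficient of \<open>x ^ i * y ^ j\<close>.
\<close>

definition eval2 :: "'a::comm_semiring_1 poly poly \<Rightarrow> 'a \<Rightarrow> 'a \<Rightarrow> 'a"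
  where "eval2 Q x y = poly (poly Q [:y:]) x"

text \<open>The supremum is a maximum unless \<open>Q = 0\<close>, where it is \<open>-\<infinity>\<close>.\<close>

definition total_degree :: "'a::zero poly poly \<Rightarrow> ereal"
  where "total_degree Q =
    (SUP (i, j) \<in> {(i, j). coeff (coeff Q j) i \<noteq> 0}. ereal (real (i + j)))"

end

theory Submission
  imports Defs "HOL-Computational_Algebra.Primes"
begin

text \<open>
  The proof is the polynomial method. Let \<open>C\<close> be the set of sums to be counted and suppose that it
  is smaller than claimed. Put \<open>N = n + card C\<close>. The polynomial
  \[ F(x,y) = (x^k y^m (x+y)^n - Q(x,y)) \prod_{c \in C} (x + y - c) \]
  vanishes on \<open>A \<times> B\<close>: at a point where the first factor is nonzero, the sum of the
  coordinates lies in \<open>C\<close>. Since \<open>Q\<close> has small degree, the terms of top degree of \<open>F\<close> are those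
  of \<open>x ^ k * y ^ m * (x + y) ^ N\<close>, and they are \<open>x ^ (k + s) * y ^ (m + t)\<close> with
  coefficient \<open>N choose s\<close>, where \<open>s + t = N\<close>. The bound
  \<open>N \<le> card A + card B - k - m - 2\<close> allows a choice of \<open>s\<close> and \<open>t\<close> with \<open>k + s < card A\<close> and
  \<open>m + t < card B\<close>, and the bound \<open>N < p\<close> makes \<open>N choose s\<close> nonzero in the field.

  Such a top coefficient can be computed from the values of \<open>F\<close> on \<open>A \<times> B\<close>, so it must be zero,
  a contradiction. The computation is the combinatorial Nullstellensatz in quantitative
  form. A set with \<open>a + 1\<close> elements carries weights whose moments of order less than \<open>a\<close> vanish and
  whose moment of order \<open>a\<close> is \<open>1\<close> (\<open>exists_top_weights\<close>). Taking the product of two such weights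
  gives a linear functional on functions of two variables that maps a polynomial of degree
  at most \<open>a + b\<close> to its coefficient at \<open>x ^ a * y ^ b\<close> (\<open>pairing_monomial\<close>,
  \<open>pairing_poly_sum\<close>).
\<close>

definition top_weights :: "'a::field set \<Rightarrow> nat \<Rightarrow> ('a \<Rightarrow> 'a) \<Rightarrow> bool"
  where "top_weights A a w \<longleftrightarrow> (\<forall>i\<le>a. (\<Sum>x\<in>A. w x * x ^ i) = (if i = a then 1 else 0))"

text \<open>
  The weights are those of the divided difference of order \<open>a\<close> at the nodes \<open>A\<close>. They are built by
  adding one node \<open>c\<close> at a time: dividing the old weights by \<open>x - c\<close> makes the new moments \<open>M\<close>
  satisfy that \<open>M (i + 1) - c * M i\<close> is the old moment of order \<open>i\<close>, and the weight at \<open>c\<close>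
  is chosen to make \<open>M 0 = 0\<close>.
\<close>

lemma exists_top_weights:
  fixes A :: "'a::field set"
  assumes "card A = Suc a"
  shows "\<exists>w. top_weights A a w"
  using assms
proof (induction a arbitrary: A)
  case 0
  then obtain x where "A = {x}" by (auto simp: card_1_singleton_iff)
  then have "top_weights A 0 (\<lambda>_. 1)" by (simp add: top_weights_def)
  then show ?case by blast
next
  case (Suc a)
  then obtain c A' where A: "A = insert c A'" and c: "c \<notin> A'" and A': "card A' = Suc a"
    by (metis card_Suc_eq)
  have fin: "finite A'" using A' by (simp add: card_ge_0_finite)
  obtain w where w: "top_weights A' a w" using Suc.IH[OF A'] by blast
  define w' where "w' = (\<lambda>x. if x = c then - (\<Sum>z\<in>A'. w z / (z - c)) else w x / (x - c))"
  define M where "M = (\<lambda>i. \<Sum>x\<in>A. w' x * x ^ i)"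
  have off_c: "(\<Sum>x\<in>A'. w' x * f x) = (\<Sum>x\<in>A'. w x / (x - c) * f x)" for f
    by (rule sum.cong) (use c in \<open>auto simp: w'_def\<close>)
  have M0: "M 0 = 0"
    using off_c[of "\<lambda>_. 1"] fin c by (simp add: M_def A w'_def)
  have step: "M (Suc i) = c * M i + (if i = a then 1 else 0)" if "i \<le> a" for i
  proof -
    have "M (Suc i) - c * M i = (\<Sum>x\<in>A. w' x * (x ^ i * (x - c)))"
      by (simp add: M_def sum_distrib_left sum_subtractf algebra_simps)
    also have "\<dots> = (\<Sum>x\<in>A'. w x / (x - c) * (x ^ i * (x - c)))"
      using fin c by (simp add: A off_c)
    also have "\<dots> = (\<Sum>x\<in>A'. w x * x ^ i)"
      by (rule sum.cong) (use c in auto)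
    also have "\<dots> = (if i = a then 1 else 0)"
      using w that by (simp add: top_weights_def)
    finally show ?thesis by (simp add: algebra_simps)
  qed
  have low: "M i = 0" if "i \<le> a" for i
    using that by (induction i) (simp_all add: M0 step)
  have "M i = (if i = Suc a then 1 else 0)" if "i \<le> Suc a" for i
  proof (cases "i = Suc a")
    case True
    then show ?thesis using step[of a] low[of a] by simp
  next
    case False
    then show ?thesis using low[of i] that by simp
  qed
  then have "top_weights A (Suc a) w'"
    by (simp add: top_weights_def M_def)
  then show ?case by blast
qed

definition pairing :: "'a::field set \<Rightarrow> 'a set \<Rightarrow> ('a \<Rightarrow> 'a) \<Rightarrow> ('a \<Rightarrow> 'a) \<Rightarrow> ('a \<Rightarrow> 'a \<Rightarrow> 'a) \<Rightarrow> 'a"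
  where "pairing A B w v f = (\<Sum>x\<in>A. \<Sum>y\<in>B. w x * v y * f x y)"

lemma pairing_cong:
  "(\<And>x y. x \<in> A \<Longrightarrow> y \<in> B \<Longrightarrow> f x y = g x y) \<Longrightarrow> pairing A B w v f = pairing A B w v g"
  by (simp add: pairing_def)

lemma pairing_sum: "pairing A B w v (\<lambda>x y. \<Sum>i\<in>I. f i x y) = (\<Sum>i\<in>I. pairing A B w v (f i))"
  unfolding pairing_def
  by (simp add: sum_distrib_left sum.swap[of _ I])

lemma pairing_scale: "pairing A B w v (\<lambda>x y. c * f x y) = c * pairing A B w v f"
  by (simp add: pairing_def sum_distrib_left algebra_simps)

text \<open>
  If \<open>s + t \<le> a + b\<close> and \<open>(s, t) \<noteq> (a, b)\<close>, then \<open>s < a\<close> or \<open>t < b\<close>, so one of the two factors of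
  the product of moments vanishes.
\<close>

lemma pairing_monomial:
  assumes "top_weights A a w" and "top_weights B b v" and "s + t \<le> a + b"
  shows "pairing A B w v (\<lambda>x y. x ^ s * y ^ t) = (if s = a \<and> t = b then 1 else 0)"
proof -
  have split: "pairing A B w v (\<lambda>x y. x ^ s * y ^ t) = (\<Sum>x\<in>A. w x * x ^ s) * (\<Sum>y\<in>B. v y * y ^ t)"
    unfolding pairing_def sum_product by (simp add: mult_ac)
  consider "s < a" | "t < b" | "s = a" "t = b" using assms(3) by linarith
  then show ?thesis
    unfolding split using assms(1,2) by cases (auto simp: top_weights_def)
qed

lemma pairing_poly_sum_expand:
  fixes A B :: "'a::field set"
  shows "pairing A B w v (\<lambda>x y. x ^ i * y ^ j * poly h (x + y)) =
    (\<Sum>l\<le>degree h. \<Sum>s\<le>l. coeff h l * of_nat (l choose s) *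
       pairing A B w v (\<lambda>x y. x ^ (i + s) * y ^ (j + (l - s))))"
proof -
  have "x ^ i * y ^ j * poly h (x + y) =
      (\<Sum>l\<le>degree h. \<Sum>s\<le>l. coeff h l * of_nat (l choose s) * (x ^ (i + s) * y ^ (j + (l - s))))"
    for x y :: 'a
    unfolding poly_altdef binomial_ring sum_distrib_left
    by (intro sum.cong refl) (simp only: power_add mult_ac)
  then show ?thesis
    by (simp add: pairing_sum pairing_scale)
qed

text \<open>Every monomial of the expansion has degree less than \<open>a + b\<close>.\<close>

lemma pairing_poly_sum_low:
  assumes "top_weights A a w" and "top_weights B b v" and "i + j + degree h < a + b"
  shows "pairing A B w v (\<lambda>x y. x ^ i * y ^ j * poly h (x + y)) = 0"
proof -
  have "pairing A B w v (\<lambda>x y. x ^ (i + s) * y ^ (j + (l - s))) = 0"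
    if "l \<le> degree h" "s \<le> l" for l s
    using assms(3) that by (subst pairing_monomial[OF assms(1,2)]) auto
  then show ?thesis by (simp add: pairing_poly_sum_expand)
qed

text \<open>
  Only the leading term of \<open>h\<close> contributes to the top degree, and the binomial theorem gives the
  coefficient of \<open>x ^ s * y ^ t\<close> in \<open>(x + y) ^ (s + t)\<close>.
\<close>

lemma pairing_poly_sum:
  assumes "top_weights A (i + s) w" and "top_weights B (j + t) v" and "degree h = s + t"
  shows "pairing A B w v (\<lambda>x y. x ^ i * y ^ j * poly h (x + y)) =
    lead_coeff h * of_nat ((s + t) choose s)"
proof -
  let ?c = "\<lambda>l r. coeff h l * of_nat (l choose r)"
  have "pairing A B w v (\<lambda>x y. x ^ i * y ^ j * poly h (x + y)) =
      (\<Sum>l\<le>s + t. \<Sum>r\<le>l. ?c l r * (if r = s then if l = s + t then 1 else 0 else 0))"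
    unfolding pairing_poly_sum_expand assms(3)
    by (intro sum.cong refl arg_cong2[where f = "(*)"], subst pairing_monomial[OF assms(1,2)]) auto
  also have "\<dots> = (\<Sum>l\<le>s + t. if l = s + t then ?c (s + t) s else 0)"
    by (intro sum.cong refl) (simp add: if_distrib[of "(*) _"] cong: if_cong)
  finally show ?thesis by (simp add: assms(3))
qed

lemma less_of_total_degree_less:
  assumes "total_degree Q < ereal (real d)" and "coeff (coeff Q j) i \<noteq> 0"
  shows "i + j < d"
proof -
  have "ereal (real (i + j)) \<le> total_degree Q"
    unfolding total_degree_def using assms(2) by (intro SUP_upper2[of "(i, j)"]) auto
  then have "ereal (real (i + j)) < ereal (real d)" using assms(1) by (rule le_less_trans)
  then show ?thesis by simp
qed

lemma eval2_altdef:
  "eval2 Q x y = (\<Sum>j\<le>degree Q. \<Sum>i\<le>degree (coeff Q j). coeff (coeff Q j) i * (x ^ i * y ^ j))"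
  unfolding eval2_def poly_altdef[of Q] poly_sum poly_mult poly_power
    poly_altdef[of "coeff Q _"] sum_distrib_right
  by (simp add: mult_ac)

text \<open>
  A nonzero characteristic is a prime; if it divided \<open>N choose s\<close>, it would divide \<open>fact N\<close>, all of
  whose prime factors are at most \<open>N\<close>.
\<close>

lemma of_nat_choose_neq_0:
  assumes "CHAR('a::field) = 0 \<or> N < CHAR('a)" and "s \<le> N"
  shows "of_nat (N choose s) \<noteq> (0 :: 'a)"
proof
  assume "of_nat (N choose s) = (0 :: 'a)"
  then have dvd: "CHAR('a) dvd (N choose s)" by (simp add: of_nat_eq_0_iff_char_dvd)
  have choose_dvd: "(N choose s) dvd fact N"
    using binomial_fact_lemma[OF assms(2)] by (metis dvd_triv_right)
  show False
  proof (cases "CHAR('a) = 0")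
    case True
    then show False using dvd assms(2) by simp
  next
    case False
    then have "prime CHAR('a)" using prime_CHAR_semidom by blast
    then have "CHAR('a) \<le> N" using dvd choose_dvd prime_dvd_fact_iff dvd_trans by blast
    then show False using assms(1) False by simp
  qed
qed

theorem corollary1:
  fixes A B :: "'a::field set"
    and k m n :: nat
    and Q :: "'a poly poly"
  assumes "finite A" and "finite B"
    and "total_degree Q < ereal (real (k + m + n))"
    and "card A > k" and "card B > m"
  shows "ereal (real (card {a + b | a b. a \<in> A \<and> b \<in> B \<and>
                              a ^ k * b ^ m * (a + b) ^ n \<noteq> eval2 Q a b}))
         \<ge> min (ext_char TYPE('a) - ereal (real n))
               (ereal (real (card A) + real (card B) - real k - real m - real n - 1))"
proof (rule ccontr)
  define C where "C = {a + b | a b. a \<in> A \<and> b \<in> B \<and> a ^ k * b ^ m * (a + b) ^ n \<noteq> eval2 Q a b}"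
  define N where "N = n + card C"
  assume "\<not> ?thesis"
  then have small_char: "ereal (real (card C)) < ext_char TYPE('a) - ereal (real n)"
    and small_card:
      "real (card C) < real (card A) + real (card B) - real k - real m - real n - 1"
    by (simp_all add: C_def not_le)
  have char: "CHAR('a) = 0 \<or> N < CHAR('a)"
    using small_char by (auto simp: ext_char_def N_def split: if_splits)
  have card: "N + k + m + 2 \<le> card A + card B"
    using small_card unfolding N_def by linarith
  have "C \<subseteq> (\<lambda>(a, b). a + b) ` (A \<times> B)" by (auto simp: C_def)
  then have finC: "finite C" using assms(1,2) by (meson finite_SigmaI finite_imageI finite_subset)

  \<comment> \<open>The greedy choice: \<open>s\<close> is as large as \<open>A\<close> permits.\<close>
  define s where "s = min N (card A - k - 1)"
  define t where "t = N - s"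
  have st: "s + t = N" and sA: "Suc (k + s) \<le> card A" and tB: "Suc (m + t) \<le> card B"
    using card assms(4,5) by (auto simp: s_def t_def)
  obtain A' where A': "A' \<subseteq> A" "card A' = Suc (k + s)"
    using sA by (meson obtain_subset_with_card_n)
  obtain B' where B': "B' \<subseteq> B" "card B' = Suc (m + t)"
    using tB by (meson obtain_subset_with_card_n)
  obtain w where w: "top_weights A' (k + s) w" using exists_top_weights[OF A'(2)] by blast
  obtain v where v: "top_weights B' (m + t) v" using exists_top_weights[OF B'(2)] by blast
  let ?L = "pairing A' B' w v"

  define g where "g = (\<Prod>c\<in>C. [:- c, 1:])"
  have deg_g: "degree g = card C"
    by (simp add: g_def degree_prod_sum_eq)
  have monic_g: "lead_coeff g = 1"
    by (simp add: g_def lead_coeff_prod)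
  \<comment> \<open>With this \<open>h\<close>, the two parts of \<open>F\<close> are \<open>x ^ k * y ^ m * h(x + y)\<close> and \<open>Q(x, y) * g(x + y)\<close>.\<close>
  define h where "h = monom 1 n * g"
  have "g \<noteq> 0" using monic_g by auto
  moreover have deg_monom: "degree (monom (1::'a) n) = n" by (simp add: degree_monom_eq)
  ultimately have deg_h: "degree h = s + t"
    by (simp add: h_def st N_def deg_g degree_mult_eq)
  have monic_h: "lead_coeff h = 1"
    using monic_g by (simp add: h_def lead_coeff_mult deg_monom)

  \<comment> \<open>This is the vanishing of \<open>F\<close> on \<open>A' \<times> B'\<close>.\<close>
  have "x ^ k * y ^ m * poly h (x + y) = eval2 Q x y * poly g (x + y)"
    if "x \<in> A'" "y \<in> B'" for x y
  proof (cases "x ^ k * y ^ m * (x + y) ^ n = eval2 Q x y")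
    case True
    then show ?thesis by (simp add: h_def poly_monom flip: mult.assoc)
  next
    case False
    then have "x + y \<in> C" using that A'(1) B'(1) by (auto simp: C_def)
    then have "poly g (x + y) = 0" using finC by (auto simp: g_def poly_prod)
    then show ?thesis by (simp add: h_def)
  qed
  then have "?L (\<lambda>x y. x ^ k * y ^ m * poly h (x + y)) = ?L (\<lambda>x y. eval2 Q x y * poly g (x + y))"
    by (rule pairing_cong)
  also have "\<dots> = (\<Sum>j\<le>degree Q. \<Sum>i\<le>degree (coeff Q j).
      coeff (coeff Q j) i * ?L (\<lambda>x y. x ^ i * y ^ j * poly g (x + y)))"
    by (simp add: eval2_altdef sum_distrib_right pairing_sum mult.assoc pairing_scale)
  also have "\<dots> = 0"
  proof (intro sum.neutral ballI)
    fix i j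
    show "coeff (coeff Q j) i * ?L (\<lambda>x y. x ^ i * y ^ j * poly g (x + y)) = 0"
    proof (cases "coeff (coeff Q j) i = 0")
      case False
      then have "i + j < k + m + n" by (rule less_of_total_degree_less[OF assms(3)])
      then have "i + j + degree g < (k + s) + (m + t)" using st by (simp add: deg_g N_def)
      then show ?thesis using pairing_poly_sum_low[OF w v] by simp
    qed simp
  qed
  finally have "of_nat (N choose s) = (0 :: 'a)"
    using pairing_poly_sum[OF w v deg_h] monic_h st by simp
  then show False
    using of_nat_choose_neq_0[OF char] st by simp
qed

end
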